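(* Let $G=(V,E)$ be a simplicial graph, let $K$ be a simplicial clique of $G$, and let $T=T^{\boxtimes}_K(G)$ be the simplicial clique tree of $G$ with respect to $K$. Let $I(T)=I^{\phi_K}(T)$ denote the relative independence polynomial of $T$ with respect to the labeling $\phi_K:T\to G$. Then $$\frac{I(G)}{I(G\setminus K)}=\frac{I(T)}{I(T\setminus K)},$$ where $T\setminus K$ is $T$ with its root clique removed and $I(T\setminus K)$ is the relative independence polynomial with respect to the restriction of $\phi_K$.
   Context: All graphs are finite, simple and undirected. A graph is claw-free if it has no induced $K_{1,3}$. A clique $K$ (set of pairwise adjacent vertices) in $G$ is a simplicial clique if for every $u\in K$ the set $N[u]\cap(G\setminus K)$, i.e. the set of neighbors of $u$ outside $K$, is a clique. A graph is simplicial if it is claw-free and contains a simplicial clique. The multivariate independence polynomial is $I(G)(\mathbf{x})=\sum_{S\subseteq V,\ S\text{ independent}}\prod_{v\in S}x_v$. Given a graph homomorphism $\phi:H\to G$, the relative independence polynomial of $H$ is $I^{\phi}(H)(\mathbf{x})=\sum_{S\subseteq V(H),\ S\text{ independent}}\prod_{v\in S}x_{\phi(v)}$, in variables indexed by $V(G)$. Simplicial clique tree: for $G$ simplicial with simplicial clique $K$, $T^{\boxtimes}_K(G)$ is defined recursively. If $G=K$, then $T^{\boxtimes}_K(G)=G$ with root clique $K$, each vertex labeled by itself. In general, for $u\in K$ let $J_u:=N[u]\cap(G\setminus K)$; it is known that, $G$ being claw-free, $J_u$ is a (possibly empty) simplicial clique of $G\setminus K$. Take the disjoint union of the labeled graphs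 $T^{\boxtimes}_{J_u}(G\setminus K)$ over all $u\in K$ (with $T^{\boxtimes}_{\emptyset}$ of any graph being the empty graph), add a copy of the clique $K$ (the root clique, each vertex labeled by itself), and join each $u\in K$ to every vertex of the root clique of $T^{\boxtimes}_{J_u}(G\setminus K)$. The labels define a graph homomorphism $\phi_K:T^{\boxtimes}_K(G)\to G$. *)

theory Defs
  imports
    "Graph_Theory.Kuratowski"
    "HOL-Computational_Algebra.Polynomial"
    "HOL-Computational_Algebra.Fraction_Field"
    "HOL-Library.Poly_Mapping"
begin

section \<open>Multivariate polynomials\<close>

typedef 'v mpoly = "UNIV :: (('v \<Rightarrow>\<^sub>0 nat) \<Rightarrow>\<^sub>0 int) set"
  by simp

text \<open>
  The polynomial ring $\mathbb{Z}[x_v : v]$ over an arbitrary type of variables, whose field of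
  fractions is \<^typ>\<open>'v mpoly fract\<close>. The type copy is needed because the library makes
  \<^typ>\<open>('v \<Rightarrow>\<^sub>0 nat) \<Rightarrow>\<^sub>0 int\<close> an integral domain only for linearly ordered \<open>'v\<close>.
\<close>

setup_lifting type_definition_mpoly

instantiation mpoly :: (type) comm_ring_1
begin

lift_definition zero_mpoly :: "'v mpoly" is 0 .
lift_definition one_mpoly :: "'v mpoly" is 1 .
lift_definition plus_mpoly :: "'v mpoly \<Rightarrow> 'v mpoly \<Rightarrow> 'v mpoly" is "(+)" .
lift_definition minus_mpoly :: "'v mpoly \<Rightarrow> 'v mpoly \<Rightarrow> 'v mpoly" is "(-)" .
lift_definition uminus_mpoly :: "'v mpoly \<Rightarrow> 'v mpoly" is uminus .
lift_definition times_mpoly :: "'v mpoly \<Rightarrow> 'v mpoly \<Rightarrow> 'v mpoly" is "(*)" .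

instance
  by standard (transfer, simp add: algebra_simps)+

end

lemma lookup_mult_keys:
  fixes f g :: "'a::monoid_add \<Rightarrow>\<^sub>0 'b::semiring_0"
  shows "Poly_Mapping.lookup (f * g) k =
    (\<Sum>l\<in>Poly_Mapping.keys f. \<Sum>q\<in>Poly_Mapping.keys g. if k = l + q then Poly_Mapping.lookup f l * Poly_Mapping.lookup g q else 0)"
proof -
  have inner: "(\<Sum>q. Poly_Mapping.lookup g q when k = l + q)
      = (\<Sum>q\<in>Poly_Mapping.keys g. Poly_Mapping.lookup g q when k = l + q)" for l
    by (rule Sum_any.expand_superset) (auto simp: in_keys_iff)
  have "Poly_Mapping.lookup (f * g) k = (\<Sum>l. Poly_Mapping.lookup f l * (\<Sum>q\<in>Poly_Mapping.keys g. Poly_Mapping.lookup g q when k = l + q))"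
    by (simp add: lookup_mult inner)
  also have "\<dots> = (\<Sum>l\<in>Poly_Mapping.keys f. Poly_Mapping.lookup f l * (\<Sum>q\<in>Poly_Mapping.keys g. Poly_Mapping.lookup g q when k = l + q))"
    by (rule Sum_any.expand_superset) (auto simp: in_keys_iff)
  also have "\<dots> = (\<Sum>l\<in>Poly_Mapping.keys f. \<Sum>q\<in>Poly_Mapping.keys g. if k = l + q then Poly_Mapping.lookup f l * Poly_Mapping.lookup g q else 0)"
    by (auto simp: sum_distrib_left when_def intro!: sum.cong)
  finally show ?thesis .
qed

lemma mult_neq_0_if_weight:
  fixes f g :: "('v \<Rightarrow>\<^sub>0 nat) \<Rightarrow>\<^sub>0 int"
    and W :: "('v \<Rightarrow>\<^sub>0 nat) \<Rightarrow> 'w::{linorder, ordered_cancel_ab_semigroup_add}"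
  assumes add: "\<And>m n. W (m + n) = W m + W n"
    and inj: "inj_on W (Poly_Mapping.keys f)" "inj_on W (Poly_Mapping.keys g)"
    and nz: "f \<noteq> 0" "g \<noteq> 0"
  shows "f * g \<noteq> 0"
proof -
  have "\<exists>a\<in>Poly_Mapping.keys h. \<forall>l\<in>Poly_Mapping.keys h. W l \<le> W a" if "h \<noteq> 0" for h :: "('v \<Rightarrow>\<^sub>0 nat) \<Rightarrow>\<^sub>0 int"
  proof -
    have "Max (W ` Poly_Mapping.keys h) \<in> W ` Poly_Mapping.keys h"
      using that by (intro Max_in) auto
    then obtain a where a: "a \<in> Poly_Mapping.keys h" "W a = Max (W ` Poly_Mapping.keys h)"
      by auto
    moreover have "W l \<le> Max (W ` Poly_Mapping.keys h)" if "l \<in> Poly_Mapping.keys h" for l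
      using that by (intro Max_ge) auto
    ultimately show ?thesis
      by (intro bexI[of _ a]) auto
  qed
  from this[OF nz(1)] this[OF nz(2)] obtain a b
    where a: "a \<in> Poly_Mapping.keys f" "\<And>l. l \<in> Poly_Mapping.keys f \<Longrightarrow> W l \<le> W a"
      and b: "b \<in> Poly_Mapping.keys g" "\<And>q. q \<in> Poly_Mapping.keys g \<Longrightarrow> W q \<le> W b"
    by blast
  have uniq: "l = a \<and> q = b" if "l \<in> Poly_Mapping.keys f" "q \<in> Poly_Mapping.keys g" "a + b = l + q" for l q
  proof -
    have eq: "W a + W b = W l + W q"
      using add[of a b] add[of l q] that(3) by simp
    have "W l = W a"
    proof (rule ccontr)
      assume "W l \<noteq> W a"
      with a(2)[OF that(1)] have "W l < W a" by simp
      then have "W l + W q < W a + W b"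
        using b(2)[OF that(2)] by (rule add_less_le_mono)
      with eq show False by simp
    qed
    then have "l = a"
      using inj(1) a(1) that(1) by (auto dest: inj_onD)
    then show ?thesis
      using that(3) by simp
  qed
  have "Poly_Mapping.lookup (f * g) (a + b)
      = (\<Sum>l\<in>Poly_Mapping.keys f. \<Sum>q\<in>Poly_Mapping.keys g. if a + b = l + q then Poly_Mapping.lookup f l * Poly_Mapping.lookup g q else 0)"
    by (rule lookup_mult_keys)
  also have "\<dots> = (\<Sum>l\<in>Poly_Mapping.keys f. \<Sum>q\<in>Poly_Mapping.keys g. if l = a \<and> q = b then Poly_Mapping.lookup f l * Poly_Mapping.lookup g q else 0)"
    by (intro sum.cong refl if_cong) (use uniq in auto)
  also have "\<dots> = (\<Sum>l\<in>Poly_Mapping.keys f. if l = a then Poly_Mapping.lookup f a * Poly_Mapping.lookup g b else 0)"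
    using b(1) by (intro sum.cong refl) auto
  also have "\<dots> = Poly_Mapping.lookup f a * Poly_Mapping.lookup g b"
    using a(1) by simp
  finally have "Poly_Mapping.lookup (f * g) (a + b) \<noteq> 0"
    using a(1) b(1) by (simp add: in_keys_iff)
  then show ?thesis
    by auto
qed

lemma ex_weight:
  fixes A :: "('v \<Rightarrow>\<^sub>0 nat) set"
  assumes "finite A"
  shows "\<exists>W :: ('v \<Rightarrow>\<^sub>0 nat) \<Rightarrow> int poly. (\<forall>m n. W (m + n) = W m + W n) \<and> inj_on W A"
proof -
  define V where "V = (\<Union>m\<in>A. Poly_Mapping.keys m)"
  have "finite V"
    using assms by (simp add: V_def)
  then obtain h :: "'v \<Rightarrow> nat" where h: "inj_on h V"
    by (meson finite_imp_inj_to_nat_seg)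
  define W where "W m = (\<Sum>v\<in>V. monom (int (Poly_Mapping.lookup m v)) (h v))" for m :: "'v \<Rightarrow>\<^sub>0 nat"
  have "W (m + n) = W m + W n" for m n
    unfolding W_def lookup_add of_nat_add add_monom[symmetric] by (rule sum.distrib)
  moreover have "inj_on W A"
  proof (rule inj_onI)
    fix m n assume mn: "m \<in> A" "n \<in> A" "W m = W n"
    have co: "coeff (W m) (h v) = int (Poly_Mapping.lookup m v)" if "v \<in> V" for m v
    proof -
      have "coeff (W m) (h v) = (\<Sum>u\<in>V. if u = v then int (Poly_Mapping.lookup m v) else 0)"
        unfolding W_def coeff_sum
        by (rule sum.cong) (simp_all add: inj_on_eq_iff[OF h] that)
      also have "\<dots> = int (Poly_Mapping.lookup m v)"
        using \<open>finite V\<close> that by simp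
      finally show ?thesis .
    qed
    show "m = n"
    proof (rule poly_mapping_eqI)
      fix v
      show "Poly_Mapping.lookup m v = Poly_Mapping.lookup n v"
      proof (cases "v \<in> V")
        case True
        with co[of v m] co[of v n] mn(3) show ?thesis by simp
      next
        case False
        then have "v \<notin> Poly_Mapping.keys m" "v \<notin> Poly_Mapping.keys n"
          using mn by (auto simp: V_def)
        then show ?thesis by (simp add: in_keys_iff)
      qed
    qed
  qed
  ultimately show ?thesis by blast
qed

instance mpoly :: (type) idom
proof
  fix a b :: "'a mpoly"
  assume "a \<noteq> 0" "b \<noteq> 0"
  then show "a * b \<noteq> 0"
  proof transfer
    fix f g :: "('a \<Rightarrow>\<^sub>0 nat) \<Rightarrow>\<^sub>0 int"
    assume "f \<noteq> 0" "g \<noteq> 0"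
    obtain W :: "('a \<Rightarrow>\<^sub>0 nat) \<Rightarrow> int poly"
      where W: "\<And>m n. W (m + n) = W m + W n" "inj_on W (Poly_Mapping.keys f \<union> Poly_Mapping.keys g)"
      using ex_weight[OF finite_UnI[OF finite_keys finite_keys]] by blast
    from W(2) have "inj_on W (Poly_Mapping.keys f)" "inj_on W (Poly_Mapping.keys g)"
      by (simp_all add: inj_on_Un)
    from mult_neq_0_if_weight[OF W(1) this \<open>f \<noteq> 0\<close> \<open>g \<noteq> 0\<close>] show "f * g \<noteq> 0" .
  qed
qed

lift_definition Var :: "'v \<Rightarrow> 'v mpoly" is
  "\<lambda>v. Poly_Mapping.single (Poly_Mapping.single v 1) 1" .


section \<open>Graphs\<close>

text \<open>
  A finite simple undirected graph is a \<^locale>\<open>pair_graph\<close>: a finite loopfree digraph without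
  parallel arcs whose arc set is symmetric, each edge being represented by both of its orientations.
\<close>

definition del_verts :: "'a pair_pre_digraph \<Rightarrow> 'a set \<Rightarrow> 'a pair_pre_digraph" where
  "del_verts G S = \<lparr> pverts = pverts G - S, parcs = {(u, v) \<in> parcs G. u \<notin> S \<and> v \<notin> S} \<rparr>"

definition graph_hom :: "('a \<Rightarrow> 'b) \<Rightarrow> 'a pair_pre_digraph \<Rightarrow> 'b pair_pre_digraph \<Rightarrow> bool" where
  "graph_hom \<phi> H G \<longleftrightarrow>
    (\<forall>v \<in> pverts H. \<phi> v \<in> pverts G) \<and> (\<forall>(u, v) \<in> parcs H. (\<phi> u, \<phi> v) \<in> parcs G)"

definition claw_free :: "'a pair_pre_digraph \<Rightarrow> bool" where
  "claw_free G \<longleftrightarrow> \<not> (\<exists>H. induced_subgraph H (with_proj G) \<and> K\<^bsub>1,3\<^esub> H)"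

definition clique :: "'a pair_pre_digraph \<Rightarrow> 'a set \<Rightarrow> bool" where
  "clique G K \<longleftrightarrow> K \<subseteq> pverts G \<and> (\<forall>u\<in>K. \<forall>v\<in>K. u \<noteq> v \<longrightarrow> (u, v) \<in> parcs G)"

definition closed_nbhd :: "'a pair_pre_digraph \<Rightarrow> 'a \<Rightarrow> 'a set" where
  "closed_nbhd G u = insert u {v. (u, v) \<in> parcs G}"

definition outer_nbhd :: "'a pair_pre_digraph \<Rightarrow> 'a set \<Rightarrow> 'a \<Rightarrow> 'a set" where
  "outer_nbhd G K u = closed_nbhd G u \<inter> pverts (del_verts G K)"

text \<open>
  The empty set counts as a simplicial clique, because the sets \<^term>\<open>outer_nbhd G K u\<close> at which the
  recursion below continues may be empty. A theorem about simplicial graphs in this sense covers in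
  particular the reading in which a simplicial clique has to be nonempty.
\<close>

definition simplicial_clique :: "'a pair_pre_digraph \<Rightarrow> 'a set \<Rightarrow> bool" where
  "simplicial_clique G K \<longleftrightarrow> clique G K \<and> (\<forall>u\<in>K. clique G (outer_nbhd G K u))"

definition simplicial_graph :: "'a pair_pre_digraph \<Rightarrow> bool" where
  "simplicial_graph G \<longleftrightarrow> claw_free G \<and> (\<exists>K. simplicial_clique G K)"


section \<open>Independence polynomials\<close>

definition independent :: "'a pair_pre_digraph \<Rightarrow> 'a set \<Rightarrow> bool" where
  "independent G S \<longleftrightarrow> S \<subseteq> pverts G \<and> (\<forall>u\<in>S. \<forall>v\<in>S. (u, v) \<notin> parcs G)"

definition indep_poly :: "'v pair_pre_digraph \<Rightarrow> 'v mpoly" where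
  "indep_poly G = (\<Sum>S | independent G S. \<Prod>v\<in>S. Var v)"

definition rel_indep_poly :: "('a \<Rightarrow> 'v) \<Rightarrow> 'a pair_pre_digraph \<Rightarrow> 'v mpoly" where
  "rel_indep_poly \<phi> H = (\<Sum>S | independent H S. \<Prod>v\<in>S. Var (\<phi> v))"

lemma const_coeff_mult:
  fixes f g :: "('v \<Rightarrow>\<^sub>0 nat) \<Rightarrow>\<^sub>0 int"
  shows "Poly_Mapping.lookup (f * g) 0 = Poly_Mapping.lookup f 0 * Poly_Mapping.lookup g 0"
proof -
  have zero: "0 = l + q \<longleftrightarrow> l = 0 \<and> q = 0" for l q :: "'v \<Rightarrow>\<^sub>0 nat"
    by (auto simp: poly_mapping_eq_iff lookup_add fun_eq_iff)
  have "Poly_Mapping.lookup (f * g) 0 = (\<Sum>l\<in>Poly_Mapping.keys f. \<Sum>q\<in>Poly_Mapping.keys g.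
      if q = 0 then if l = 0 then Poly_Mapping.lookup f 0 * Poly_Mapping.lookup g 0 else 0 else 0)"
    unfolding lookup_mult_keys by (intro sum.cong refl) (auto simp: zero)
  then show ?thesis
    by (cases "Poly_Mapping.lookup g 0 = 0") (simp_all add: in_keys_iff)
qed

lift_definition const_coeff :: "'v mpoly \<Rightarrow> int" is "\<lambda>p. Poly_Mapping.lookup p 0" .

text \<open>Independence polynomials have constant term 1, so they may serve as denominators.\<close>

lemma rel_indep_poly_neq_0:
  assumes "finite (pverts H)"
  shows "rel_indep_poly \<phi> H \<noteq> 0"
proof -
  have add: "const_coeff (p + q) = const_coeff p + const_coeff q" for p q :: "'b mpoly"
    by transfer (simp add: lookup_add)
  have mult: "const_coeff (p * q) = const_coeff p * const_coeff q" for p q :: "'b mpoly"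
    by transfer (rule const_coeff_mult)
  have zero: "const_coeff (0 :: 'b mpoly) = 0"
    by transfer simp
  have one: "const_coeff (1 :: 'b mpoly) = 1"
    by transfer simp
  have var: "const_coeff (Var v) = 0" for v :: 'b
  proof transfer
    fix v :: 'b
    have "Poly_Mapping.single v (1 :: nat) \<noteq> 0"
      by (metis lookup_single_eq lookup_zero zero_neq_one)
    then show "Poly_Mapping.lookup (Poly_Mapping.single (Poly_Mapping.single v (1 :: nat)) (1 :: int)) 0 = 0"
      by (simp add: lookup_single when_def)
  qed
  have fin: "finite {S. independent H S}"
    by (rule finite_subset[of _ "Pow (pverts H)"]) (use assms in \<open>auto simp: independent_def\<close>)
  have prod: "const_coeff (\<Prod>v\<in>S. Var (\<phi> v)) = (if S = {} then 1 else 0)" if "finite S" for S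
    using that by induction (simp_all add: one mult var)
  have sum: "const_coeff (\<Sum>S\<in>A. h S) = (\<Sum>S\<in>A. const_coeff (h S))"
    for A :: "'a set set" and h :: "'a set \<Rightarrow> 'b mpoly"
    by (induction A rule: infinite_finite_induct) (simp_all add: zero add)
  have "const_coeff (rel_indep_poly \<phi> H) = (\<Sum>S | independent H S. if S = {} then 1 else 0)"
    unfolding rel_indep_poly_def sum
    by (intro sum.cong refl prod) (use assms finite_subset in \<open>auto simp: independent_def\<close>)
  also have "\<dots> = 1"
    using fin by (simp add: independent_def)
  finally show ?thesis
    using zero by auto
qed

lemma indep_poly_neq_0: "finite (pverts G) \<Longrightarrow> indep_poly G \<noteq> 0"
  using rel_indep_poly_neq_0[of G id] by (simp add: indep_poly_def rel_indep_poly_def)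


section \<open>The simplicial clique tree\<close>

text \<open>
  The disjoint unions in the recursive construction are realised on nonempty lists of vertices of
  \<open>G\<close>: the copy of \<open>u \<in> K\<close> in the root clique is the list \<open>[u]\<close>, and a vertex \<open>p\<close> of the subtree
  hanging off \<open>u\<close> becomes \<open>u # p\<close>. Thus a vertex is the path of labels leading to it from the root
  clique, and its own label is the last entry of that path.
\<close>

definition root_clique :: "'v set \<Rightarrow> 'v list set" where
  "root_clique K = (\<lambda>u. [u]) ` K"

definition tree_label :: "'v list \<Rightarrow> 'v" where
  "tree_label p = last p"

text \<open>
  The first branch of the definition also covers the case that \<open>K\<close> is all of \<open>G\<close>: then every
  \<^term>\<open>outer_nbhd G K u\<close> is empty, and the result is the copy of \<open>K\<close>.
\<close>

function simplicial_clique_tree :: "'v pair_pre_digraph \<Rightarrow> 'v set \<Rightarrow> 'v list pair_pre_digraph" where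
  "simplicial_clique_tree G K =
    (if finite (pverts G) \<and> K \<subseteq> pverts G \<and> K \<noteq> {} then
       let J = outer_nbhd G K;
           T = (\<lambda>u. simplicial_clique_tree (del_verts G K) (J u))
       in \<lparr> pverts = root_clique K \<union> {u # p | u p. u \<in> K \<and> p \<in> pverts (T u)},
            parcs = {([u], [v]) | u v. u \<in> K \<and> v \<in> K \<and> (u, v) \<in> parcs G}
              \<union> {(u # p, u # q) | u p q. u \<in> K \<and> (p, q) \<in> parcs (T u)}
              \<union> {([u], u # r) | u r. u \<in> K \<and> r \<in> root_clique (J u)}
              \<union> {(u # r, [u]) | u r. u \<in> K \<and> r \<in> root_clique (J u)} \<rparr>
     else \<lparr> pverts = {}, parcs = {} \<rparr>)"
  by pat_completeness auto
termination
proof (relation "measure (\<lambda>(G, K). card (pverts G))", goal_cases)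
  case (2 G K)
  then have "pverts G - K \<subset> pverts G" by auto
  with 2 show ?case by (auto simp: del_verts_def intro: psubset_card_mono)
qed simp

declare simplicial_clique_tree.simps [simp del]


section \<open>Well-formedness of the construction\<close>

lemma pair_graph_iff:
  "pair_graph G \<longleftrightarrow> finite (pverts G) \<and> parcs G \<subseteq> pverts G \<times> pverts G \<and> sym (parcs G) \<and> irrefl (parcs G)"
    (is "?L \<longleftrightarrow> ?R")
proof
  assume ?L
  then interpret pair_graph G .
  show ?R
  proof (intro conjI)
    show "finite (pverts G)" by (rule pair_finite_verts)
    show "parcs G \<subseteq> pverts G \<times> pverts G" using wellformed' by auto
    show "sym (parcs G)" using arcs_symmetric by (rule symI)
    show "irrefl (parcs G)" using no_loops' by (intro irreflI) blast
  qed
next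
  assume R: ?R
  then have "finite (parcs G)"
    by (meson finite_SigmaI finite_subset)
  with R show ?L
    by unfold_locales (auto simp: symmetric_def irrefl_def)
qed

lemma pair_graph_del_verts: "pair_graph G \<Longrightarrow> pair_graph (del_verts G S)"
  unfolding pair_graph_iff del_verts_def by (auto simp: sym_def irrefl_def)

lemma outer_nbhd_subset: "outer_nbhd G K u \<subseteq> pverts (del_verts G K)"
  by (simp add: outer_nbhd_def)

lemma root_clique_subset_tree:
  assumes "finite (pverts G)" "K \<subseteq> pverts G"
  shows "root_clique K \<subseteq> pverts (simplicial_clique_tree G K)"
  using assms by (subst simplicial_clique_tree.simps) (auto simp: root_clique_def Let_def)

theorem pair_graph_simplicial_clique_tree:
  assumes "pair_graph G"
  shows "pair_graph (simplicial_clique_tree G K) \<and> [] \<notin> pverts (simplicial_clique_tree G K)"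
  using assms
proof (induction G K rule: simplicial_clique_tree.induct)
  case (1 G K)
  show ?case
  proof (cases "finite (pverts G) \<and> K \<subseteq> pverts G \<and> K \<noteq> {}")
    case False
    then show ?thesis
      by (subst (1 2) simplicial_clique_tree.simps) (auto simp: pair_graph_iff sym_def irrefl_def)
  next
    case True
    define T where "T u = simplicial_clique_tree (del_verts G K) (outer_nbhd G K u)" for u
    have T: "pair_graph (T u)" "[] \<notin> pverts (T u)" for u
      using "1.IH"[OF True] pair_graph_del_verts[OF "1.prems"] by (auto simp: T_def)
    have eq: "simplicial_clique_tree G K =
      \<lparr> pverts = root_clique K \<union> {u # p | u p. u \<in> K \<and> p \<in> pverts (T u)},
        parcs = {([u], [v]) | u v. u \<in> K \<and> v \<in> K \<and> (u, v) \<in> parcs G}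
          \<union> {(u # p, u # q) | u p q. u \<in> K \<and> (p, q) \<in> parcs (T u)}
          \<union> {([u], u # r) | u r. u \<in> K \<and> r \<in> root_clique (outer_nbhd G K u)}
          \<union> {(u # r, [u]) | u r. u \<in> K \<and> r \<in> root_clique (outer_nbhd G K u)} \<rparr>"
      using True by (subst simplicial_clique_tree.simps) (simp add: T_def Let_def)
    have root: "root_clique (outer_nbhd G K u) \<subseteq> pverts (T u)" for u
      unfolding T_def
      by (intro root_clique_subset_tree outer_nbhd_subset)
        (use True in \<open>simp add: del_verts_def\<close>)
    have "{u # p | u p. u \<in> K \<and> p \<in> pverts (T u)} = (\<Union>u\<in>K. (#) u ` pverts (T u))"
      by auto
    moreover have "finite K"
      using True finite_subset by blast
    ultimately have "finite (pverts (simplicial_clique_tree G K))"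
      using T(1) by (simp add: eq root_clique_def pair_graph_iff)
    moreover have "parcs (simplicial_clique_tree G K)
      \<subseteq> pverts (simplicial_clique_tree G K) \<times> pverts (simplicial_clique_tree G K)"
      using T(1) root by (fastforce simp: eq root_clique_def pair_graph_iff)
    moreover have "sym (parcs (simplicial_clique_tree G K))"
      using T(1) "1.prems" unfolding eq pair_graph_iff sym_def by auto
    moreover have "irrefl (parcs (simplicial_clique_tree G K))"
      using T(1) "1.prems" unfolding eq pair_graph_iff irrefl_def root_clique_def by auto
    ultimately have "pair_graph (simplicial_clique_tree G K)"
      by (simp add: pair_graph_iff)
    moreover have "[] \<notin> pverts (simplicial_clique_tree G K)"
      by (auto simp: eq root_clique_def)
    ultimately show ?thesis by simp
  qed
qed

theorem graph_hom_tree_label: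
  assumes "pair_graph G"
  shows "graph_hom tree_label (simplicial_clique_tree G K) G"
  using assms
proof (induction G K rule: simplicial_clique_tree.induct)
  case (1 G K)
  show ?case
  proof (cases "finite (pverts G) \<and> K \<subseteq> pverts G \<and> K \<noteq> {}")
    case False
    then show ?thesis
      by (subst simplicial_clique_tree.simps) (auto simp: graph_hom_def)
  next
    case True
    define T where "T u = simplicial_clique_tree (del_verts G K) (outer_nbhd G K u)" for u
    have T: "pair_graph (T u)" "[] \<notin> pverts (T u)" "graph_hom tree_label (T u) (del_verts G K)" for u
      using "1.IH"[OF True refl] pair_graph_del_verts[OF "1.prems"]
        pair_graph_simplicial_clique_tree[OF pair_graph_del_verts[OF "1.prems"]]
      by (simp_all add: T_def)
    have eq: "simplicial_clique_tree G K =
      \<lparr> pverts = root_clique K \<union> {u # p | u p. u \<in> K \<and> p \<in> pverts (T u)},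
        parcs = {([u], [v]) | u v. u \<in> K \<and> v \<in> K \<and> (u, v) \<in> parcs G}
          \<union> {(u # p, u # q) | u p q. u \<in> K \<and> (p, q) \<in> parcs (T u)}
          \<union> {([u], u # r) | u r. u \<in> K \<and> r \<in> root_clique (outer_nbhd G K u)}
          \<union> {(u # r, [u]) | u r. u \<in> K \<and> r \<in> root_clique (outer_nbhd G K u)} \<rparr>"
      using True by (subst simplicial_clique_tree.simps) (simp add: T_def Let_def)
    have v: "last (u # p) \<in> pverts G" if "p \<in> pverts (T u)" for u p
      using T(2,3)[of u] that by (auto simp: graph_hom_def tree_label_def del_verts_def)
    have a: "(last (u # p), last (u # q)) \<in> parcs G" if "(p, q) \<in> parcs (T u)" for u p q
    proof -
      have "p \<noteq> []" "q \<noteq> []"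
        using T(1,2)[of u] that by (auto simp: pair_graph_iff)
      then show ?thesis
        using T(3)[of u] that by (auto simp: graph_hom_def tree_label_def del_verts_def)
    qed
    have j: "(u, r) \<in> parcs G" "(r, u) \<in> parcs G" if "u \<in> K" "r \<in> outer_nbhd G K u" for u r
      using that "1.prems"
      by (auto simp: outer_nbhd_def closed_nbhd_def del_verts_def pair_graph_iff sym_def)
    show ?thesis
      using True v a j unfolding graph_hom_def eq tree_label_def root_clique_def
      by (auto simp del: last.simps simp: last.simps[of _ "[]"] last.simps[of _ "_ # _"])
  qed
qed

end

theory Submission
  imports Defs
begin

text \<open>
  Splitting the independent sets of \<open>G\<close> by their at most one element in the clique \<open>K\<close> gives
  \<open>I(G) = I(G - K) + (\<Sum>u\<in>K. x\<^sub>u I(G - K - J\<^sub>u))\<close>. The same expansion holds for \<open>T\<close> and its root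
  clique, and there the removal of the root clique leaves the disjoint union of the subtrees \<open>T\<^sub>u\<close>,
  so every summand factors over the branches. Claw-freeness makes each \<open>J\<^sub>u\<close> a simplicial clique of
  \<open>G - K\<close>; by induction \<open>I(G - K - J\<^sub>u) / I(G - K)\<close> equals \<open>I(T\<^sub>u - J\<^sub>u) / I(T\<^sub>u)\<close>, and the two
  expansions agree summand by summand.
\<close>

section \<open>Claw-free graphs and simplicial cliques\<close>

text \<open>Otherwise the subgraph of \<open>G\<close> induced on \<open>w\<close>,
  \<open>x\<close>, \<open>y\<close>, \<open>z\<close> would be a star with centre
  \<open>w\<close>.\<close>

lemma claw_freeD:
  assumes "pair_graph G" "claw_free G"
    and edges: "(w, x) \<in> parcs G" "(w, y) \<in> parcs G" "(w, z) \<in> parcs G"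
    and distinct: "x \<noteq> y" "x \<noteq> z" "y \<noteq> z"
  shows "(x, y) \<in> parcs G \<or> (x, z) \<in> parcs G \<or> (y, z) \<in> parcs G"
proof (rule ccontr)
  assume "\<not> ?thesis"
  then have non: "(x, y) \<notin> parcs G" "(x, z) \<notin> parcs G" "(y, z) \<notin> parcs G"
    by auto
  interpret G: pair_graph G by fact
  have sym: "(a, b) \<in> parcs G \<Longrightarrow> (b, a) \<in> parcs G" for a b
    using G.arcs_symmetric by blast
  have loop: "(a, a) \<notin> parcs G" for a
    using G.no_loops' by blast
  define U where "U = {w}"
  define V where "V = {x, y, z}"
  define H where "H = \<lparr>pverts = U \<union> V, parcs = U \<times> V \<union> V \<times> U\<rparr>"
  have UV: "U \<inter> V = {}" "card U = 1" "card V = 3"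
    using edges distinct loop by (auto simp: U_def V_def)
  have "K\<^bsub>1,3\<^esub> (with_proj H)"
    unfolding complete_bipartite_digraph_pair_def
  proof (intro conjI)
    show "finite (pverts H)"
      by (simp add: H_def U_def V_def)
    show "\<exists>U V. pverts H = U \<union> V \<and> U \<inter> V = {} \<and> card U = 1 \<and> card V = 3 \<and>
        parcs H = U \<times> V \<union> V \<times> U"
      by (rule exI[of _ U], rule exI[of _ V]) (use UV in \<open>simp add: H_def\<close>)
  qed
  moreover have "with_proj H = with_proj G \<restriction> (U \<union> V)"
  proof -
    have "(w, a) \<in> parcs G" if "a \<in> V" for a
      using that edges by (auto simp: V_def)
    moreover from this have "(a, w) \<in> parcs G" if "a \<in> V" for a
      using that sym by blast
    moreover have "(a, b) \<notin> parcs G" if "a \<in> V" "b \<in> V" for a b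
      using that non sym loop unfolding V_def by blast
    ultimately have "U \<times> V \<union> V \<times> U = {e \<in> parcs G. fst e \<in> U \<union> V \<and> snd e \<in> U \<union> V}"
      using loop[of w] by (auto simp: U_def)
    then show ?thesis
      by (simp add: with_proj_def induce_subgraph_def H_def)
  qed
  moreover have "induced_subgraph (with_proj G \<restriction> (U \<union> V)) (with_proj G)"
    using edges assms(1) by (intro G.induced_induce) (auto simp: U_def V_def pair_graph_iff)
  ultimately show False
    using \<open>claw_free G\<close> by (auto simp: claw_free_def)
qed

text \<open>Converse of \<open>claw_freeD\<close>. The adjacency criterion passes to vertex
  deletions directly, without comparing nested induced subgraphs.\<close>

lemma claw_freeI:
  assumes "\<And>w x y z. (w, x) \<in> parcs G \<Longrightarrow> (w, y) \<in> parcs G \<Longrightarrow> (w, z) \<in> parcs G \<Longrightarrow>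
      x \<noteq> y \<Longrightarrow> x \<noteq> z \<Longrightarrow> y \<noteq> z \<Longrightarrow>
      (x, y) \<in> parcs G \<or> (x, z) \<in> parcs G \<or> (y, z) \<in> parcs G"
  shows "claw_free G"
  unfolding claw_free_def
proof
  assume "\<exists>H. induced_subgraph H (with_proj G) \<and> K\<^bsub>1,3\<^esub> H"
  then obtain H U V where H: "induced_subgraph H (with_proj G)"
    and UV: "verts H = U \<union> V" "U \<inter> V = {}" "card U = 1" "card V = 3"
      "arcs_ends H = U \<times> V \<union> V \<times> U"
    unfolding complete_bipartite_digraph_def by blast
  \<comment> \<open>An induced subgraph shares the end maps of \<open>with_proj G\<close>, so
    adjacency in \<open>H\<close> is that of \<open>G\<close> on the vertices of
    \<open>H\<close>.\<close>
  have ends: "arcs_ends H = {(a, b) \<in> parcs G. a \<in> verts H \<and> b \<in> verts H}"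
    using H by (auto simp: induced_subgraph_def subgraph_def compatible_def arcs_ends_conv image_iff)
  obtain w where w: "U = {w}"
    using UV(3) by (auto simp: card_1_singleton_iff)
  obtain x y z where V: "V = {x, y, z}" and ne: "x \<noteq> y" "x \<noteq> z" "y \<noteq> z"
    using UV(4) by (auto simp: card_3_iff)
  have "(w, a) \<in> parcs G" if "a \<in> V" for a
    using that UV(5) w ends by blast
  moreover have "(a, b) \<notin> parcs G" if "a \<in> V" "b \<in> V" for a b
    using that UV ends by blast
  ultimately show False
    using assms[of w x y z] V ne by blast
qed

lemma claw_free_del_verts:
  assumes "pair_graph G" "claw_free G"
  shows "claw_free (del_verts G S)"
  using claw_freeD[OF assms] by (intro claw_freeI) (fastforce simp: del_verts_def)

text \<open>Write J for \<open>outer_nbhd G K u\<close>. If \<open>w\<close> in J had two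
  nonadjacent neighbours outside \<open>K\<close> and J, these and \<open>u\<close> would be the
  leaves of a claw centred at \<open>w\<close>: no vertex outside \<open>K\<close> and J is adjacent
  to \<open>u\<close>.\<close>

lemma simplicial_clique_outer_nbhd:
  assumes G: "pair_graph G" "claw_free G" and K: "simplicial_clique G K" and u: "u \<in> K"
  shows "simplicial_clique (del_verts G K) (outer_nbhd G K u)"
proof -
  let ?G' = "del_verts G K" and ?J = "outer_nbhd G K u"
  have J: "clique G ?J"
    using K u by (simp add: simplicial_clique_def)
  then have "clique ?G' ?J"
    by (auto simp: clique_def outer_nbhd_def del_verts_def)
  moreover have "clique ?G' (outer_nbhd ?G' ?J w)" if w: "w \<in> ?J" for w
    unfolding clique_def
  proof (intro conjI ballI impI)
    show "outer_nbhd ?G' ?J w \<subseteq> pverts ?G'"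
      by (auto simp: outer_nbhd_def del_verts_def)
  next
    fix a b assume ab: "a \<in> outer_nbhd ?G' ?J w" "b \<in> outer_nbhd ?G' ?J w" "a \<noteq> b"
    have "(u, w) \<in> parcs G"
      using w u by (auto simp: outer_nbhd_def closed_nbhd_def del_verts_def)
    then have "(w, u) \<in> parcs G"
      using G(1) by (auto simp: pair_graph_iff sym_def)
    moreover have "(w, a) \<in> parcs G" "(w, b) \<in> parcs G"
      using ab w by (auto simp: outer_nbhd_def closed_nbhd_def del_verts_def)
    moreover have "a \<noteq> u" "b \<noteq> u" "(u, a) \<notin> parcs G" "(u, b) \<notin> parcs G"
      using ab u by (auto simp: outer_nbhd_def closed_nbhd_def del_verts_def)
    ultimately have "(a, b) \<in> parcs G"
      using claw_freeD[OF G, of w u a b] ab(3) by blast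
    then show "(a, b) \<in> parcs ?G'"
      using ab by (auto simp: outer_nbhd_def del_verts_def)
  qed
  ultimately show ?thesis
    by (simp add: simplicial_clique_def)
qed

lemma del_verts_empty: "del_verts G {} = G"
  by (simp add: del_verts_def)

text \<open>A clique containing \<open>u\<close> lies in the closed neighbourhood of
  \<open>u\<close>, which is therefore \<open>K\<close> together with
  \<open>outer_nbhd G K u\<close> and can be removed in two stages.\<close>

lemma del_verts_closed_nbhd:
  assumes "pair_graph G" "clique G K" "u \<in> K"
  shows "del_verts G (closed_nbhd G u) = del_verts (del_verts G K) (outer_nbhd G K u)"
  using assms by (auto simp: del_verts_def closed_nbhd_def outer_nbhd_def clique_def pair_graph_iff)


section \<open>Independence polynomials\<close>

text \<open>Lets the clique expansion be proved once, for relative polynomials, and serve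
  \<open>G\<close> as well as its tree.\<close>

lemma indep_poly_eq_rel: "indep_poly G = rel_indep_poly (\<lambda>v. v) G"
  by (simp add: indep_poly_def rel_indep_poly_def)

lemma independent_del_verts: "independent (del_verts G A) S \<longleftrightarrow> independent G S \<and> S \<inter> A = {}"
  by (auto simp: independent_def del_verts_def)

lemma finite_independent_sets: "finite (pverts G) \<Longrightarrow> finite {S. independent G S}"
  by (rule finite_subset[of _ "Pow (pverts G)"]) (auto simp: independent_def)

lemma independent_finite: "finite (pverts G) \<Longrightarrow> independent G S \<Longrightarrow> finite S"
  by (auto simp: independent_def intro: finite_subset)

text \<open>An independent set contains at most one vertex of a clique. The sets missing
  \<open>K\<close> give the first summand; those containing \<open>u\<close> arise by adding
  \<open>u\<close> to an independent set that avoids the closed neighbourhood of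
  \<open>u\<close>.\<close>

lemma rel_indep_poly_clique_expansion:
  assumes G: "pair_graph G" and K: "clique G K"
  shows "rel_indep_poly \<phi> G = rel_indep_poly \<phi> (del_verts G K) +
    (\<Sum>u\<in>K. Var (\<phi> u) * rel_indep_poly \<phi> (del_verts G (closed_nbhd G u)))"
proof -
  let ?p = "\<lambda>S. \<Prod>v\<in>S. Var (\<phi> v)"
  let ?N = "\<lambda>u. {S. independent (del_verts G (closed_nbhd G u)) S}"
  \<comment> \<open>For \<open>u\<close> in \<open>K\<close> these turn out to be exactly the
    independent sets through \<open>u\<close>.\<close>
  let ?I = "\<lambda>u. insert u ` ?N u"
  have finG: "finite (pverts G)" and sym: "sym (parcs G)" and irr: "irrefl (parcs G)"
    using G by (auto simp: pair_graph_iff)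
  have finK: "finite K"
    using finG K by (auto simp: clique_def intro: finite_subset)
  have fin: "finite {S. independent (del_verts G A) S}" for A
    using finG by (intro finite_independent_sets) (simp add: del_verts_def)
  have ne: "u \<notin> S" if "S \<in> ?N u" for u S
    using that by (auto simp: independent_del_verts closed_nbhd_def)
  have I_iff: "S \<in> ?I u \<longleftrightarrow> independent G S \<and> u \<in> S" if "u \<in> K" for u S
  proof
    assume "S \<in> ?I u"
    then obtain S' where "S = insert u S'" "independent G S'" "S' \<inter> closed_nbhd G u = {}"
      by (auto simp: independent_del_verts)
    then show "independent G S \<and> u \<in> S"
      using that K sym irr by (auto simp: closed_nbhd_def independent_def clique_def sym_def irrefl_def)
  next
    assume S: "independent G S \<and> u \<in> S"
    then have "S = insert u (S - {u})" "S - {u} \<in> ?N u"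
      unfolding independent_del_verts mem_Collect_eq by (auto simp: closed_nbhd_def independent_def)
    then show "S \<in> ?I u"
      by blast
  qed
  have UN_I: "(\<Union>u\<in>K. ?I u) = {S. independent G S \<and> S \<inter> K \<noteq> {}}"
  proof (rule set_eqI)
    fix S
    have "S \<in> (\<Union>u\<in>K. ?I u) \<longleftrightarrow> (\<exists>u\<in>K. S \<in> ?I u)"
      by (rule UN_iff)
    also have "\<dots> \<longleftrightarrow> (\<exists>u\<in>K. independent G S \<and> u \<in> S)"
      by (rule bex_cong[OF refl I_iff])
    finally show "S \<in> (\<Union>u\<in>K. ?I u) \<longleftrightarrow> S \<in> {S. independent G S \<and> S \<inter> K \<noteq> {}}"
      by blast
  qed
  have "{S. independent G S} = {S. independent (del_verts G K) S} \<union> (\<Union>u\<in>K. ?I u)"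
    unfolding UN_I by (auto simp: independent_del_verts)
  moreover have "{S. independent (del_verts G K) S} \<inter> (\<Union>u\<in>K. ?I u) = {}"
    unfolding UN_I by (auto simp: independent_del_verts)
  moreover have "finite (\<Union>u\<in>K. ?I u)"
    by (intro finite_UN_I finK finite_imageI fin)
  ultimately have "rel_indep_poly \<phi> G = rel_indep_poly \<phi> (del_verts G K) + sum ?p (\<Union>u\<in>K. ?I u)"
    unfolding rel_indep_poly_def by (simp only: sum.union_disjoint fin)
  \<comment> \<open>Distinct vertices of the clique are adjacent, so no independent set is counted
    twice.\<close>
  moreover have "?I u \<inter> ?I v = {}" if "u \<in> K" "v \<in> K" "u \<noteq> v" for u v
  proof (intro equals0I)
    fix S assume "S \<in> ?I u \<inter> ?I v"
    then have "independent G S" "u \<in> S" "v \<in> S"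
      unfolding Int_iff I_iff[OF that(1)] I_iff[OF that(2)] by simp_all
    with K that show False
      unfolding independent_def clique_def by blast
  qed
  then have "sum ?p (\<Union>u\<in>K. ?I u) = (\<Sum>u\<in>K. sum ?p (?I u))"
    by (intro sum.UNION_disjoint finK ballI impI finite_imageI fin)
  moreover have "sum ?p (?I u) = Var (\<phi> u) * rel_indep_poly \<phi> (del_verts G (closed_nbhd G u))"
    if "u \<in> K" for u
  proof -
    have "inj_on (insert u) (?N u)"
      using ne by (intro inj_onI) (metis insert_ident)
    then have "sum ?p (?I u) = (\<Sum>S\<in>?N u. ?p (insert u S))"
      by (simp add: sum.reindex)
    also have "\<dots> = (\<Sum>S\<in>?N u. Var (\<phi> u) * ?p S)"
    proof (rule sum.cong)
      fix S assume S: "S \<in> ?N u"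
      then have "finite S"
        using finG by (auto simp: independent_del_verts dest: independent_finite)
      with ne[OF S] show "?p (insert u S) = Var (\<phi> u) * ?p S"
        by simp
    qed simp
    finally show ?thesis
      by (simp add: rel_indep_poly_def sum_distrib_left)
  qed
  ultimately show ?thesis
    by simp
qed

section \<open>Disjoint unions of branches\<close>

text \<open>Disjoint union in the path encoding of the tree. The family \<open>F\<close> is left
  arbitrary so that a single branch can be replaced when vertices are deleted from it.\<close>

definition branches :: "'v set \<Rightarrow> ('v \<Rightarrow> 'v list pair_pre_digraph) \<Rightarrow> 'v list pair_pre_digraph" where
  "branches K F = \<lparr>pverts = {u # p | u p. u \<in> K \<and> p \<in> pverts (F u)},
     parcs = {(u # p, u # q) | u p q. u \<in> K \<and> (p, q) \<in> parcs (F u)}\<rparr>"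

text \<open>No arc joins two branches, so an independent set amounts to a free choice of one
  independent set per branch. Prefixing \<open>u\<close> keeps the last entry of a path only if the
  path is nonempty, hence the exclusion of \<open>[]\<close>.\<close>

lemma rel_indep_poly_branches:
  assumes K: "finite K"
    and F: "\<And>u. u \<in> K \<Longrightarrow> finite (pverts (F u))" "\<And>u. u \<in> K \<Longrightarrow> [] \<notin> pverts (F u)"
  shows "rel_indep_poly tree_label (branches K F) = (\<Prod>u\<in>K. rel_indep_poly tree_label (F u))"
proof -
  let ?p = "\<lambda>S. \<Prod>v\<in>S. Var (tree_label v)"
  let ?A = "\<lambda>u. {S. independent (F u) S}"
  let ?join = "\<lambda>g. \<Union>u\<in>K. (#) u ` g u"
  \<comment> \<open>Restriction to \<open>K\<close> sends every other vertex to
    \<open>undefined\<close>, as membership in \<open>PiE\<close> demands.\<close>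
  let ?split = "\<lambda>S. \<lambda>u\<in>K. {p. u # p \<in> S}"
  have "(\<Prod>u\<in>K. rel_indep_poly tree_label (F u)) = (\<Sum>g\<in>PiE K ?A. \<Prod>u\<in>K. ?p (g u))"
    unfolding rel_indep_poly_def using K F(1)
    by (intro prod_sum_PiE finite_independent_sets)
  also have "\<dots> = rel_indep_poly tree_label (branches K F)"
    unfolding rel_indep_poly_def
  proof (rule sum.reindex_bij_witness[of _ ?split ?join])
    fix g assume g: "g \<in> PiE K ?A"
    show "?split (?join g) = g"
      using g by (auto simp: fun_eq_iff PiE_def extensional_def)
    show "?join g \<in> {S. independent (branches K F) S}"
      using g by (fastforce simp: independent_def branches_def PiE_def Pi_def)
    have ind: "independent (F u) (g u)" if "u \<in> K" for u
      using that g by auto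
    have fin: "finite (g u)" if "u \<in> K" for u
      using that F(1) ind independent_finite by blast
    have nil: "[] \<notin> g u" if "u \<in> K" for u
      using that F(2) ind by (auto simp: independent_def)
    have "?p (?join g) = (\<Prod>u\<in>K. ?p ((#) u ` g u))"
      using K fin by (intro prod.UNION_disjoint) auto
    also have "\<dots> = (\<Prod>u\<in>K. ?p (g u))"
    proof (rule prod.cong)
      fix u assume u: "u \<in> K"
      have "?p ((#) u ` g u) = (\<Prod>p\<in>g u. Var (tree_label (u # p)))"
        by (simp add: prod.reindex)
      also have "\<dots> = ?p (g u)"
        using nil[OF u] by (intro prod.cong) (auto simp: tree_label_def)
      finally show "?p ((#) u ` g u) = ?p (g u)" .
    qed simp
    finally show "?p (?join g) = (\<Prod>u\<in>K. ?p (g u))" .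
  next
    fix S assume S: "S \<in> {S. independent (branches K F) S}"
    then show "?join (?split S) = S"
      by (fastforce simp: independent_def branches_def)
    show "?split S \<in> PiE K ?A"
      using S by (fastforce simp: independent_def branches_def PiE_def Pi_def)
  qed
  finally show ?thesis by simp
qed


section \<open>Deletions in the simplicial clique tree\<close>

context
  fixes G :: "'v pair_pre_digraph" and K :: "'v set"
    and J :: "'v \<Rightarrow> 'v set" and F :: "'v \<Rightarrow> 'v list pair_pre_digraph"
  assumes G: "pair_graph G" and K: "clique G K" "K \<noteq> {}"
  defines "J \<equiv> outer_nbhd G K"
    and "F \<equiv> \<lambda>u. simplicial_clique_tree (del_verts G K) (J u)"
begin

lemma subtree: "pair_graph (F u)" "[] \<notin> pverts (F u)"
  using pair_graph_simplicial_clique_tree[OF pair_graph_del_verts[OF G]] by (auto simp: F_def)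

text \<open>A path \<open>[]\<close> in the branch at \<open>u\<close> would become the root vertex
  \<open>[u]\<close> after prefixing; its absence keeps the root clique apart from the
  branches.\<close>

lemma Nil_notin_arcs: "([], q) \<notin> parcs (F u)" "(p, []) \<notin> parcs (F u)"
  using subtree[of u] by (auto simp: pair_graph_iff)

text \<open>Separates the branches from the root clique and the arcs attached to it, so that the
  deletions below can be read off.\<close>

lemma tree_unfold:
  "simplicial_clique_tree G K =
    \<lparr> pverts = root_clique K \<union> pverts (branches K F),
      parcs = {([u], [v]) | u v. u \<in> K \<and> v \<in> K \<and> (u, v) \<in> parcs G}
        \<union> parcs (branches K F)
        \<union> {([u], u # r) | u r. u \<in> K \<and> r \<in> root_clique (J u)}
        \<union> {(u # r, [u]) | u r. u \<in> K \<and> r \<in> root_clique (J u)} \<rparr>"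
  using G K by (subst simplicial_clique_tree.simps)
    (simp add: Let_def branches_def F_def J_def pair_graph_iff clique_def)

lemma clique_root_clique: "clique (simplicial_clique_tree G K) (root_clique K)"
  using K by (auto simp: clique_def tree_unfold root_clique_def)

lemma del_root_clique: "del_verts (simplicial_clique_tree G K) (root_clique K) = branches K F"
  by (auto simp: del_verts_def tree_unfold branches_def root_clique_def subtree(2) Nil_notin_arcs)

text \<open>The neighbours of \<open>[u]\<close> are the other root vertices and the root clique of
  the branch at \<open>u\<close>, so all other branches survive intact.\<close>

lemma del_closed_nbhd_root:
  assumes u: "u \<in> K"
  shows "del_verts (simplicial_clique_tree G K) (closed_nbhd (simplicial_clique_tree G K) [u]) =
    branches K (F(u := del_verts (F u) (root_clique (J u))))"
proof -
  have nbhd: "closed_nbhd (simplicial_clique_tree G K) [u] = root_clique K \<union> (#) u ` root_clique (J u)"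
    using u K
    by (auto simp: closed_nbhd_def tree_unfold branches_def root_clique_def clique_def Nil_notin_arcs)
  have "del_verts (simplicial_clique_tree G K) (closed_nbhd (simplicial_clique_tree G K) [u])
      = del_verts (branches K F) ((#) u ` root_clique (J u))"
    unfolding nbhd del_root_clique[symmetric] by (auto simp: del_verts_def)
  also have "\<dots> = branches K (F(u := del_verts (F u) (root_clique (J u))))"
    by (auto simp: del_verts_def branches_def split: if_splits; metis image_eqI)
  finally show ?thesis .
qed

end

section \<open>Induction along the clique tree\<close>

text \<open>The quotient identity with denominators cleared, which keeps the induction inside the
  polynomial ring.\<close>

lemma simplicial_clique_tree_cross_mult:
  assumes "pair_graph G" "claw_free G" "simplicial_clique G K"
  shows "indep_poly G *
      rel_indep_poly tree_label (del_verts (simplicial_clique_tree G K) (root_clique K)) =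
    rel_indep_poly tree_label (simplicial_clique_tree G K) * indep_poly (del_verts G K)"
  using assms
proof (induction G K rule: simplicial_clique_tree.induct)
  case (1 G K)
  note G = "1.prems"
  have K: "clique G K"
    using G(3) by (simp add: simplicial_clique_def)
  show ?case
  proof (cases "K = {}")
    \<comment> \<open>The recursion reaches this case at a vertex without neighbours outside the
      clique. Nothing is deleted, and the two sides differ only in the order of the factors.\<close>
    case True
    then show ?thesis
      by (simp add: root_clique_def del_verts_empty simplicial_clique_tree.simps)
  next
    case False
    let ?T = "simplicial_clique_tree G K" and ?G' = "del_verts G K"
    let ?I = "rel_indep_poly tree_label"
    define J where "J = outer_nbhd G K"
    define F where "F u = simplicial_clique_tree ?G' (J u)" for u
    have cond: "finite (pverts G) \<and> K \<subseteq> pverts G \<and> K \<noteq> {}"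
      using G(1) K False by (auto simp: pair_graph_iff clique_def)
    then have finK: "finite K"
      by (auto intro: finite_subset)
    have F: "finite (pverts (F u))" "[] \<notin> pverts (F u)" for u
      using subtree[OF G(1) K False, of u] by (simp_all add: F_def J_def pair_graph_iff)
    have IH: "indep_poly (del_verts ?G' (J u)) * ?I (F u) =
        indep_poly ?G' * ?I (del_verts (F u) (root_clique (J u)))" if "u \<in> K" for u
      using "1.IH"[OF cond refl pair_graph_del_verts[OF G(1)] claw_free_del_verts[OF G(1,2)]
          simplicial_clique_outer_nbhd[OF G that]]
      by (simp add: F_def J_def mult.commute)
    let ?P = "\<lambda>u. \<Prod>v\<in>K - {u}. ?I (F v)"
    have T': "?I (del_verts ?T (root_clique K)) = (\<Prod>u\<in>K. ?I (F u))"
      using del_root_clique[OF G(1) K False] rel_indep_poly_branches[OF finK F]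
      by (simp add: F_def J_def)
    \<comment> \<open>Only the factor of the branch at \<open>u\<close> changes; the untouched
      branches contribute \<open>?P u\<close>.\<close>
    have N: "?I (del_verts ?T (closed_nbhd ?T [u])) = ?I (del_verts (F u) (root_clique (J u))) * ?P u"
      if u: "u \<in> K" for u
    proof -
      let ?F = "F(u := del_verts (F u) (root_clique (J u)))"
      have "?I (del_verts ?T (closed_nbhd ?T [u])) = ?I (branches K ?F)"
        using del_closed_nbhd_root[OF G(1) K False u] by (simp add: F_def[abs_def] J_def)
      also have "\<dots> = (\<Prod>v\<in>K. ?I (?F v))"
        using F by (intro rel_indep_poly_branches finK) (auto simp: del_verts_def)
      also have "\<dots> = ?I (?F u) * (\<Prod>v\<in>K - {u}. ?I (?F v))"
        using finK u by (rule prod.remove)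
      finally show ?thesis by simp
    qed
    have "?I ?T = (\<Prod>u\<in>K. ?I (F u)) +
        (\<Sum>r\<in>root_clique K. Var (tree_label r) * ?I (del_verts ?T (closed_nbhd ?T r)))"
      using rel_indep_poly_clique_expansion[OF _ clique_root_clique[OF G(1) K False], of tree_label]
        pair_graph_simplicial_clique_tree[OF G(1)] T' by simp
    also have "(\<Sum>r\<in>root_clique K. Var (tree_label r) * ?I (del_verts ?T (closed_nbhd ?T r))) =
        (\<Sum>u\<in>K. Var u * (?I (del_verts (F u) (root_clique (J u))) * ?P u))"
      unfolding root_clique_def[of K]
      by (simp add: sum.reindex inj_on_def tree_label_def N)
    finally have T: "?I ?T = (\<Prod>u\<in>K. ?I (F u)) +
        (\<Sum>u\<in>K. Var u * (?I (del_verts (F u) (root_clique (J u))) * ?P u))" .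
    have "indep_poly G = indep_poly ?G' + (\<Sum>u\<in>K. Var u * indep_poly (del_verts ?G' (J u)))"
      using rel_indep_poly_clique_expansion[OF G(1) K, of "\<lambda>v. v"]
      by (simp add: indep_poly_eq_rel J_def del_verts_closed_nbhd[OF G(1) K])
    then have "indep_poly G * (\<Prod>u\<in>K. ?I (F u)) = indep_poly ?G' * (\<Prod>u\<in>K. ?I (F u)) +
        (\<Sum>u\<in>K. Var u * indep_poly (del_verts ?G' (J u)) * (\<Prod>u\<in>K. ?I (F u)))"
      by (simp add: distrib_right sum_distrib_right)
    \<comment> \<open>Splitting the factor of the branch at \<open>u\<close> off the product puts it
      next to the polynomial of \<open>?G'\<close> without \<open>J u\<close>, which forms the left
      side of \<open>IH\<close>.\<close>
    also have "(\<Sum>u\<in>K. Var u * indep_poly (del_verts ?G' (J u)) * (\<Prod>u\<in>K. ?I (F u))) =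
        (\<Sum>u\<in>K. Var u * (indep_poly (del_verts ?G' (J u)) * ?I (F u)) * ?P u)"
      by (intro sum.cong refl) (simp add: prod.remove[OF finK] mult_ac)
    also have "\<dots> = (\<Sum>u\<in>K. indep_poly ?G' *
        (Var u * (?I (del_verts (F u) (root_clique (J u))) * ?P u)))"
    proof (intro sum.cong refl)
      fix u assume u: "u \<in> K"
      show "Var u * (indep_poly (del_verts ?G' (J u)) * ?I (F u)) * ?P u =
          indep_poly ?G' * (Var u * (?I (del_verts (F u) (root_clique (J u))) * ?P u))"
        unfolding IH[OF u] by (simp only: mult_ac)
    qed
    finally show ?thesis
      unfolding T T' by (simp add: distrib_left sum_distrib_left mult.commute)
  qed
qed

theorem theorem4p7:
  fixes G :: "'v pair_pre_digraph" and K :: "'v set" and T :: "'v list pair_pre_digraph"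
  assumes "pair_graph G"
    and "simplicial_graph G"
    and "simplicial_clique G K"
    and "T = simplicial_clique_tree G K"
  shows "Fract (indep_poly G) (indep_poly (del_verts G K)) =
    Fract (rel_indep_poly tree_label T) (rel_indep_poly tree_label (del_verts T (root_clique K)))"
proof -
  have "pair_graph T"
    using pair_graph_simplicial_clique_tree[OF assms(1)] assms(4) by simp
  \<comment> \<open>Finiteness makes both denominators nonzero, so equality of the fractions is
    cross multiplication.\<close>
  then have "finite (pverts (del_verts T (root_clique K)))" "finite (pverts (del_verts G K))"
    using assms(1) by (auto simp: pair_graph_iff del_verts_def)
  moreover have "claw_free G"
    using assms(2) by (simp add: simplicial_graph_def)
  ultimately show ?thesis
    using simplicial_clique_tree_cross_mult[OF assms(1) _ assms(3)] assms(4)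
    by (simp add: eq_fract indep_poly_neq_0 rel_indep_poly_neq_0)
qed

end
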